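(* Let $\mathbf{O}$ be an appropriate class of operators, and suppose there exist an $\mathbf{O}$-representable $C:\mathbb{N}^2\to\mathbb{N}$ and $\mathbf{O}$-representable $L,R:\mathbb{N}\to\mathbb{N}$ with $\{(u,v)\in\mathbb{N}^2\mid C(u,v)=0\}=\{(0,0)\}$ and $\{(L(s),R(s))\mid s\in\mathbb{N}\}=\mathbb{N}^2$. Let $\mathbf{M_0},\mathbf{M_1},\mathbf{M_2}$ be effective metric spaces $\mathbf{M_i}=(M_i,d_i,A_i,\alpha_i)$ with $\mathrm{dom}(\alpha_i)\subseteq\mathbb{N}$ ($i=0,1,2$), let $\theta_0$ be a conditionally $\mathbf{O}$-computable partial function from $\mathbf{M_1}$ to $\mathbf{M_0}$ and $\theta_1$ a conditionally $\mathbf{O}$-computable partial function from $\mathbf{M_2}$ to $\mathbf{M_1}$. Then the composition $\xi\mapsto\theta_0(\theta_1(\xi))$ is a conditionally $\mathbf{O}$-computable partial function from $\mathbf{M_2}$ to $\mathbf{M_0}$.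
   Context: $\mathbb{T}_m$ is the set of total functions $\mathbb{N}^m\to\mathbb{N}$; a $k$-ary operator is a map $\mathbb{T}_1^k\to\mathbb{T}_1$; $\check{c}\in\mathbb{T}_1$ is the constant function with value $c$. A class $\mathbf{O}$ of operators is appropriate if: (1) for all $k$ and $i\le k$ the operator $(f_1,\ldots,f_k)\mapsto f_i$ is in $\mathbf{O}$; (2) the operator $F(f_1,f_2)(n)=f_1(f_2(n))$ is in $\mathbf{O}$; (3) if $F$ is $k$-ary in $\mathbf{O}$ and $G_1,\ldots,G_k$ are $l$-ary in $\mathbf{O}$, then $H(g_1,\ldots,g_l)=F(G_1(g_1,\ldots,g_l),\ldots,G_k(g_1,\ldots,g_l))$ is in $\mathbf{O}$; (4) if $F$ is $(k+1)$-ary in $\mathbf{O}$, then $G(f_1,\ldots,f_k)(n)=F(f_1,\ldots,f_k,\check{n})(n)$ is in $\mathbf{O}$. For $f:\mathbb{N}^k\to\mathbb{N}$, $\mathring{f}(f_1,\ldots,f_k)(n)=f(f_1(n),\ldots,f_k(n))$; $f$ is $\mathbf{O}$-representable if $\mathring{f}\in\mathbf{O}$. An effective metric space $(M,d,A,\alpha)$ (in the sense of Weihrauch's Computable Analysis, Def. 8.1.2) consists of a metric space $(M,d)$, a dense subset $A\subseteq M$ and a notation $\alpha$ of $A$ (a surjective partial map onto $A$); here $\mathrm{dom}(\alpha)\subseteq\mathbb{N}$. An ordinary name of $\xi\in M$ is a function $f\in\mathbb{T}_1$ with $f(t)\in\mathrm{dom}(\alpha)$ and $d(\alpha(f(t)),\xi)<\frac{1}{t+1}$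 for all $t\in\mathbb{N}$. A partial function $\theta:D\to M'$, $D\subseteq M$, from $(M,d,A,\alpha)$ to $(M',d',A',\alpha')$ is conditionally $\mathbf{O}$-computable if there exist a unary operator $E\in\mathbf{O}$ and a binary operator $T\in\mathbf{O}$ such that whenever $\xi\in D$ and $f$ is an ordinary name of $\xi$, there exists $s\in\mathbb{N}$ with $E(f)(s)=0$, and for every such $s$, $T(f,\check{s})$ is an ordinary name of $\theta(\xi)$. *)

theory Defs
  imports "HOL-Analysis.Analysis"
begin

text \<open>A \<open>k\<close>-tuple is a list of length \<open>k\<close>. A \<open>k\<close>-ary operator is a function on lists that is
  extensional on the lists of length \<open>k\<close>, so that \<^term>\<open>operators k\<close> is exactly the set of maps
  from \<open>k\<close>-tuples of unary functions to unary functions. Since operators of distinct arities are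
  distinct objects, a class of operators is a family indexed by the arity.\<close>

definition tuples :: "nat \<Rightarrow> 'a list set" where
  "tuples k = {xs. length xs = k}"

type_synonym operator = "(nat \<Rightarrow> nat) list \<Rightarrow> nat \<Rightarrow> nat"

definition operators :: "nat \<Rightarrow> operator set" where
  "operators k = tuples k \<rightarrow>\<^sub>E UNIV"

definition const_fun :: "nat \<Rightarrow> nat \<Rightarrow> nat" where
  "const_fun c = (\<lambda>_. c)"

definition appropriate :: "(nat \<Rightarrow> operator set) \<Rightarrow> bool" where
  "appropriate \<O> \<longleftrightarrow>
     (\<forall>k. \<O> k \<subseteq> operators k) \<and>
     (\<forall>k. \<forall>i<k. (\<lambda>fs\<in>tuples k. fs ! i) \<in> \<O> k) \<and>
     (\<lambda>fs\<in>tuples 2. \<lambda>n. (fs ! 0) ((fs ! 1) n)) \<in> \<O> 2 \<and>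
     (\<forall>k l. \<forall>F\<in>\<O> k. \<forall>Gs\<in>tuples k. set Gs \<subseteq> \<O> l \<longrightarrow>
        (\<lambda>gs\<in>tuples l. F (map (\<lambda>G. G gs) Gs)) \<in> \<O> l) \<and>
     (\<forall>k. \<forall>F\<in>\<O> (k + 1). (\<lambda>fs\<in>tuples k. \<lambda>n. F (fs @ [const_fun n]) n) \<in> \<O> k)"

text \<open>A \<open>k\<close>-ary number-theoretic function is also given on lists; only its values on lists of
  length \<open>k\<close> matter here.\<close>

definition pointwise :: "nat \<Rightarrow> (nat list \<Rightarrow> nat) \<Rightarrow> operator" where
  "pointwise k f = (\<lambda>fs\<in>tuples k. \<lambda>n. f (map (\<lambda>g. g n) fs))"

definition representable :: "(nat \<Rightarrow> operator set) \<Rightarrow> nat \<Rightarrow> (nat list \<Rightarrow> nat) \<Rightarrow> bool" where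
  "representable \<O> k f \<longleftrightarrow> pointwise k f \<in> \<O> k"

definition representable1 :: "(nat \<Rightarrow> operator set) \<Rightarrow> (nat \<Rightarrow> nat) \<Rightarrow> bool" where
  "representable1 \<O> f \<longleftrightarrow> representable \<O> 1 (\<lambda>xs. f (xs ! 0))"

definition representable2 :: "(nat \<Rightarrow> operator set) \<Rightarrow> (nat \<Rightarrow> nat \<Rightarrow> nat) \<Rightarrow> bool" where
  "representable2 \<O> f \<longleftrightarrow> representable \<O> 2 (\<lambda>xs. f (xs ! 0) (xs ! 1))"

record 'a metric_structure =
  points :: "'a set"
  distance :: "'a \<Rightarrow> 'a \<Rightarrow> real"
  dense_part :: "'a set"
  numbering :: "nat \<rightharpoonup> 'a"

definition effective_metric_space :: "'a metric_structure \<Rightarrow> bool" where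
  "effective_metric_space X \<longleftrightarrow>
     Metric_space (points X) (distance X) \<and>
     dense_part X \<subseteq> points X \<and>
     Metric_space.mtopology (points X) (distance X) closure_of dense_part X = points X \<and>
     ran (numbering X) = dense_part X"

definition ordinary_name :: "'a metric_structure \<Rightarrow> 'a \<Rightarrow> (nat \<Rightarrow> nat) \<Rightarrow> bool" where
  "ordinary_name X \<xi> f \<longleftrightarrow>
     \<xi> \<in> points X \<and>
     (\<forall>t. f t \<in> dom (numbering X) \<and>
          distance X (the (numbering X (f t))) \<xi> < 1 / (real t + 1))"

definition partial_function_between ::
    "'a metric_structure \<Rightarrow> 'b metric_structure \<Rightarrow> ('a \<rightharpoonup> 'b) \<Rightarrow> bool" where
  "partial_function_between X Y \<theta> \<longleftrightarrow> dom \<theta> \<subseteq> points X \<and> ran \<theta> \<subseteq> points Y"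

definition conditionally_computable ::
    "(nat \<Rightarrow> operator set) \<Rightarrow> 'a metric_structure \<Rightarrow> 'b metric_structure \<Rightarrow> ('a \<rightharpoonup> 'b) \<Rightarrow> bool" where
  "conditionally_computable \<O> X Y \<theta> \<longleftrightarrow>
     partial_function_between X Y \<theta> \<and>
     (\<exists>E\<in>\<O> 1. \<exists>T\<in>\<O> 2. \<forall>\<xi>\<in>dom \<theta>. \<forall>f. ordinary_name X \<xi> f \<longrightarrow>
        (\<exists>s. E [f] s = 0) \<and>
        (\<forall>s. E [f] s = 0 \<longrightarrow> ordinary_name Y (the (\<theta> \<xi>)) (T [f, const_fun s])))"

end

theory Submission
  imports Defs
begin

text \<open>Let \<open>E\<^sub>i, T\<^sub>i\<close> witness the computability of \<open>\<theta>\<^sub>i\<close>. A parameter \<open>s\<close> for the composition codes,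
  via \<open>L\<close> and \<open>R\<close>, a parameter \<open>L s\<close> for \<open>\<theta>\<^sub>1\<close> together with a parameter \<open>R s\<close> for \<open>\<theta>\<^sub>0\<close> at the
  name \<open>T\<^sub>1(f, L s)\<close> of \<open>\<theta>\<^sub>1(\<xi>)\<close>, and \<open>C\<close> merges the two acceptance conditions into one:
  \<open>E(f)(s) = C(E\<^sub>1(f)(L s), E\<^sub>0(T\<^sub>1(f, L s))(R s))\<close> and \<open>T(f, s) = T\<^sub>0(T\<^sub>1(f, L s), R s)\<close>.\<close>

lemma singleton_in_tuples [simp]: "[x] \<in> tuples 1" "[x] \<in> tuples (Suc 0)"
  by (simp_all add: tuples_def)

lemma pair_in_tuples [simp]: "[x, y] \<in> tuples 2"
  by (simp add: tuples_def)

lemma appropriate_projection: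
  assumes "appropriate \<O>" "i < k"
  shows "(\<lambda>fs\<in>tuples k. fs ! i) \<in> \<O> k"
  using assms by (simp add: appropriate_def)

lemma appropriate_subst:
  assumes "appropriate \<O>" "F \<in> \<O> k" "Gs \<in> tuples k" "set Gs \<subseteq> \<O> l"
  shows "(\<lambda>gs\<in>tuples l. F (map (\<lambda>G. G gs) Gs)) \<in> \<O> l"
  using assms unfolding appropriate_def by blast

text \<open>From here on the closure conditions take their arguments as terms under a restricted
  abstraction, so that membership of a composite operator can be derived by following the structure
  of its term.\<close>

lemma appropriate_subst1:
  assumes "appropriate \<O>" "F \<in> \<O> 1" "(\<lambda>gs\<in>tuples l. G gs) \<in> \<O> l"
  shows "(\<lambda>gs\<in>tuples l. F [G gs]) \<in> \<O> l"
  using appropriate_subst[of \<O> F 1 "[\<lambda>gs\<in>tuples l. G gs]" l] assms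
  by (simp cong: restrict_cong)

lemma appropriate_subst2:
  assumes "appropriate \<O>" "F \<in> \<O> 2"
    and "(\<lambda>gs\<in>tuples l. G gs) \<in> \<O> l" "(\<lambda>gs\<in>tuples l. H gs) \<in> \<O> l"
  shows "(\<lambda>gs\<in>tuples l. F [G gs, H gs]) \<in> \<O> l"
  using appropriate_subst[of \<O> F 2 "[\<lambda>gs\<in>tuples l. G gs, \<lambda>gs\<in>tuples l. H gs]" l] assms
  by (simp cong: restrict_cong)

text \<open>Substitution into the binary application operator of \<open>appropriate\<close>.\<close>

lemma appropriate_compose:
  assumes "appropriate \<O>"
    and "(\<lambda>gs\<in>tuples l. G gs) \<in> \<O> l" "(\<lambda>gs\<in>tuples l. H gs) \<in> \<O> l"
  shows "(\<lambda>gs\<in>tuples l. \<lambda>n. G gs (H gs n)) \<in> \<O> l"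
proof -
  have "(\<lambda>fs\<in>tuples 2. \<lambda>n. (fs ! 0) ((fs ! 1) n)) \<in> \<O> 2"
    using assms(1) by (simp add: appropriate_def)
  from appropriate_subst2[OF assms(1) this assms(2,3)] show ?thesis
    by simp
qed

text \<open>Turns a parameter, passed as a constant function in the last slot, into the numerical
  argument of the result. The inner restriction disappears because appending one entry gives length
  \<open>k + 1\<close>.\<close>

lemma appropriate_diagonal:
  assumes "appropriate \<O>" "(\<lambda>fs\<in>tuples (k + 1). F fs) \<in> \<O> (k + 1)"
  shows "(\<lambda>fs\<in>tuples k. \<lambda>n. F (fs @ [const_fun n]) n) \<in> \<O> k"
proof -
  have "(\<lambda>fs\<in>tuples k. \<lambda>n. (\<lambda>fs\<in>tuples (k + 1). F fs) (fs @ [const_fun n]) n) \<in> \<O> k"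
    using assms unfolding appropriate_def by blast
  also have "(\<lambda>fs\<in>tuples k. \<lambda>n. (\<lambda>fs\<in>tuples (k + 1). F fs) (fs @ [const_fun n]) n)
      = (\<lambda>fs\<in>tuples k. \<lambda>n. F (fs @ [const_fun n]) n)"
    by (intro restrict_ext) (simp add: tuples_def)
  finally show ?thesis .
qed

lemma appropriate_representable1:
  assumes "appropriate \<O>" "representable1 \<O> f" "(\<lambda>gs\<in>tuples l. G gs) \<in> \<O> l"
  shows "(\<lambda>gs\<in>tuples l. \<lambda>n. f (G gs n)) \<in> \<O> l"
  using appropriate_subst1[OF assms(1) _ assms(3), of "pointwise 1 (\<lambda>xs. f (xs ! 0))"] assms(2)
  by (simp add: representable1_def representable_def pointwise_def)

lemma appropriate_representable2:
  assumes "appropriate \<O>" "representable2 \<O> f"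
    and "(\<lambda>gs\<in>tuples l. G gs) \<in> \<O> l" "(\<lambda>gs\<in>tuples l. H gs) \<in> \<O> l"
  shows "(\<lambda>gs\<in>tuples l. \<lambda>n. f (G gs n) (H gs n)) \<in> \<O> l"
  using appropriate_subst2[OF assms(1) _ assms(3,4), of "pointwise 2 (\<lambda>xs. f (xs ! 0) (xs ! 1))"]
    assms(2)
  by (simp add: representable2_def representable_def pointwise_def)

theorem theorem4:
  fixes \<O> :: "nat \<Rightarrow> operator set"
    and C :: "nat \<Rightarrow> nat \<Rightarrow> nat"
    and L R :: "nat \<Rightarrow> nat"
    and M0 :: "'a metric_structure"
    and M1 :: "'b metric_structure"
    and M2 :: "'c metric_structure"
    and \<theta>0 :: "'b \<rightharpoonup> 'a"
    and \<theta>1 :: "'c \<rightharpoonup> 'b"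
  assumes "appropriate \<O>"
    and "representable2 \<O> C" and "representable1 \<O> L" and "representable1 \<O> R"
    and "{(u, v). C u v = 0} = {(0, 0)}"
    and "{(L s, R s) | s. True} = UNIV"
    and "effective_metric_space M0"
    and "effective_metric_space M1"
    and "effective_metric_space M2"
    and "conditionally_computable \<O> M1 M0 \<theta>0"
    and "conditionally_computable \<O> M2 M1 \<theta>1"
  shows "conditionally_computable \<O> M2 M0 (\<theta>0 \<circ>\<^sub>m \<theta>1)"
proof -
  note app = assms(1)
  obtain E0 T0 where E0: "E0 \<in> \<O> 1" and T0: "T0 \<in> \<O> 2"
    and search0: "\<And>\<xi> f. \<lbrakk>\<xi> \<in> dom \<theta>0; ordinary_name M1 \<xi> f\<rbrakk> \<Longrightarrow> \<exists>s. E0 [f] s = 0"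
    and name0: "\<And>\<xi> f s. \<lbrakk>\<xi> \<in> dom \<theta>0; ordinary_name M1 \<xi> f; E0 [f] s = 0\<rbrakk>
      \<Longrightarrow> ordinary_name M0 (the (\<theta>0 \<xi>)) (T0 [f, const_fun s])"
    using assms(10) unfolding conditionally_computable_def by metis
  obtain E1 T1 where E1: "E1 \<in> \<O> 1" and T1: "T1 \<in> \<O> 2"
    and search1: "\<And>\<xi> f. \<lbrakk>\<xi> \<in> dom \<theta>1; ordinary_name M2 \<xi> f\<rbrakk> \<Longrightarrow> \<exists>s. E1 [f] s = 0"
    and name1: "\<And>\<xi> f s. \<lbrakk>\<xi> \<in> dom \<theta>1; ordinary_name M2 \<xi> f; E1 [f] s = 0\<rbrakk>
      \<Longrightarrow> ordinary_name M1 (the (\<theta>1 \<xi>)) (T1 [f, const_fun s])"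
    using assms(11) unfolding conditionally_computable_def by metis
  have C0: "C u v = 0 \<longleftrightarrow> u = 0 \<and> v = 0" for u v
    using assms(5) by (auto simp: set_eq_iff)
  have LR: "\<exists>s. L s = u \<and> R s = v" for u v
  proof -
    have "(u, v) \<in> {(L s, R s) | s. True}"
      using assms(6) by simp
    then show ?thesis by auto
  qed

  have fst: "(\<lambda>fs\<in>tuples 2. fs ! 0) \<in> \<O> 2" and snd: "(\<lambda>fs\<in>tuples 2. fs ! 1) \<in> \<O> 2"
    using appropriate_projection[OF app] by simp_all
  note L = appropriate_representable1[OF app assms(3) snd]
  note R = appropriate_representable1[OF app assms(4) snd]
  note T1L = appropriate_subst2[OF app T1 fst L]
  \<comment> \<open>\<open>L\<close> and \<open>R\<close> act pointwise on the second argument,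
    hence send \<open>const_fun s\<close> to \<open>const_fun (L s)\<close> and
    \<open>const_fun (R s)\<close>.\<close>
  define T where "T = (\<lambda>fs\<in>tuples 2. T0 [T1 [fs ! 0, \<lambda>n. L ((fs ! 1) n)], \<lambda>n. R ((fs ! 1) n)])"
  have T: "T \<in> \<O> 2"
    unfolding T_def by (rule appropriate_subst2[OF app T0 T1L R])
  have T_eq: "T [f, const_fun s] = T0 [T1 [f, const_fun (L s)], const_fun (R s)]" for f s
    by (simp add: T_def const_fun_def)
  \<comment> \<open>\<open>T1\<close> needs the constant function with value \<open>L s\<close>,
    while in \<open>E [f] s\<close> the parameter \<open>s\<close> is only the evaluation point. So
    \<open>G\<close> first receives it as a second function argument; the diagonal \<open>E\<close>
    then puts \<open>const_fun n\<close> there.\<close>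
  define G where "G = (\<lambda>fs n. C (E1 [fs ! 0] (L ((fs ! 1) n)))
    (E0 [T1 [fs ! 0, \<lambda>n. L ((fs ! 1) n)]] (R ((fs ! 1) n))))"
  have G: "(\<lambda>fs\<in>tuples 2. G fs) \<in> \<O> 2"
    unfolding G_def
    by (rule appropriate_representable2[OF app assms(2)
          appropriate_compose[OF app appropriate_subst1[OF app E1 fst] L]
          appropriate_compose[OF app appropriate_subst1[OF app E0 T1L] R]])
  define E where "E = (\<lambda>fs\<in>tuples 1. \<lambda>n. G (fs @ [const_fun n]) n)"
  have E: "E \<in> \<O> 1"
    unfolding E_def by (rule appropriate_diagonal[OF app]) (use G in \<open>simp add: numeral_2_eq_2\<close>)
  have E_eq: "E [f] s = 0 \<longleftrightarrow> E1 [f] (L s) = 0 \<and> E0 [T1 [f, const_fun (L s)]] (R s) = 0" for f s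
    by (simp add: E_def G_def C0 const_fun_def)

  have "partial_function_between M2 M0 (\<theta>0 \<circ>\<^sub>m \<theta>1)"
    using assms(10,11)
    by (force simp: conditionally_computable_def partial_function_between_def ran_def
        map_comp_Some_iff)
  moreover have "(\<exists>s. E [f] s = 0) \<and>
      (\<forall>s. E [f] s = 0 \<longrightarrow> ordinary_name M0 (the ((\<theta>0 \<circ>\<^sub>m \<theta>1) \<xi>)) (T [f, const_fun s]))"
    if \<xi>: "\<xi> \<in> dom (\<theta>0 \<circ>\<^sub>m \<theta>1)" and f: "ordinary_name M2 \<xi> f" for \<xi> f
  proof -
    from \<xi> obtain \<eta> where \<eta>: "\<theta>1 \<xi> = Some \<eta>" "\<eta> \<in> dom \<theta>0"
      by (auto simp: dom_def map_comp_Some_iff)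
    \<comment> \<open>Kept general in \<open>s\<close>: it serves both the parameter
      \<open>s1\<close> found by search and \<open>L s\<close> for an arbitrary zero
      \<open>s\<close> of \<open>E [f]\<close>.\<close>
    have \<eta>_name: "ordinary_name M1 \<eta> (T1 [f, const_fun s])" if "E1 [f] s = 0" for s
      using name1[OF _ f that] \<eta>(1) by auto
    obtain s1 where s1: "E1 [f] s1 = 0"
      using search1[OF _ f] \<eta>(1) by auto
    \<comment> \<open>The second search runs on the name produced with \<open>s1\<close>, so
      \<open>s0\<close> depends on \<open>s1\<close>; surjectivity of the pairing then codes both in
      one number.\<close>
    obtain s0 where s0: "E0 [T1 [f, const_fun s1]] s0 = 0"
      using search0[OF \<eta>(2) \<eta>_name[OF s1]] by auto
    obtain s where "L s = s1" "R s = s0"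
      using LR by blast
    then have "E [f] s = 0"
      using s0 s1 by (simp add: E_eq)
    \<comment> \<open>Any zero of \<open>E [f]\<close> splits by \<open>E_eq\<close> into a zero
      \<open>L s\<close> of \<open>E1 [f]\<close> and a zero \<open>R s\<close> of \<open>E0\<close>
      at the resulting name of \<eta>.\<close>
    moreover have "ordinary_name M0 (the ((\<theta>0 \<circ>\<^sub>m \<theta>1) \<xi>)) (T [f, const_fun s])"
      if "E [f] s = 0" for s
      using name0[OF \<eta>(2) \<eta>_name] that \<eta>(1) by (simp add: E_eq T_eq)
    ultimately show ?thesis by blast
  qed
  ultimately show ?thesis
    unfolding conditionally_computable_def using E T by blast
qed

end
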